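(* For $n\ge1$ and $d\ge0$, $$p_{\mathrm{walk}}(n,d)=\mathbb{E}\big[p_{\mathrm{Wend}}(K_n,d)\big]=\frac1{n!}\sum_{k=d+1}^n c(n,k)\,p_{\mathrm{Wend}}(k,d).$$ For $n\ge2$ and $d\ge0$, $$p_{\mathrm{br}}(n,d)=\mathbb{E}\big[p_{\mathrm{Wend}}(K_n^{\mathrm{br}},d)\big]=\frac1{n!}\sum_{k=d+1}^{n-1}2^k\,c(n-1,k)\,p_{\mathrm{Wend}}(k,d).$$
   Context: The numbers $B(n,k)$ and the unsigned Stirling numbers of the first kind $c(n,k)$ ($n\ge1$, $k\in\mathbb{Z}$) are defined by $(t+1)(t+3)\cdots(t+2n-1)=\sum_{k\in\mathbb{Z}}B(n,k)t^k$ and $t(t+1)\cdots(t+n-1)=\sum_{k\in\mathbb{Z}}c(n,k)t^k$; they vanish for $k\notin\{0,\dots,n\}$. Empty sums are zero. Define $$p_{\mathrm{walk}}(n,d)=\frac{2}{2^nn!}\sum_{r\ge0}B(n,d+1+2r)\ (n\ge1,d\ge0),\qquad p_{\mathrm{br}}(n,d)=\frac2{n!}\sum_{r\ge0}c(n,d+2+2r)\ (n\ge2,d\ge0),$$ $$p_{\mathrm{Wend}}(n,d)=\frac1{2^{n-1}}\sum_{j=d}^{n-1}\binom{n-1}{j}\ (n\ge1,d\ge0).$$ $K_n$ is the number of cycles of a uniformly distributed random permutation of $\{1,\dots,n\}$, so $\mathbb{P}(K_n=k)=\frac1{n!}c(n,k)$, $1\le k\le n$. $K_n^{\mathrm{br}}$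 is the number of cycles of an Ewens$(2)$ random permutation of $\{1,\dots,n-1\}$ (each permutation has probability proportional to $2^{\text{number of cycles}}$), so $\mathbb{P}(K_n^{\mathrm{br}}=k)=\frac{2^k}{n!}c(n-1,k)$, $1\le k\le n-1$. *)

theory Defs
  imports
    "HOL-Computational_Algebra.Polynomial"
    "HOL-Combinatorics.Stirling"
    "HOL-Combinatorics.Orbits"
    "HOL-Probability.Probability_Mass_Function"
begin

text \<open>The coefficient of \<open>t ^ k\<close> in \<open>(t + 1) (t + 3) \<dots> (t + 2 n - 1)\<close>.\<close>

definition B_num :: "nat \<Rightarrow> nat \<Rightarrow> nat" where
  "B_num n k = coeff (\<Prod>i=1..n. [:2 * i - 1, 1:]) k"

lemma B_num_eq_0:
  assumes "n < k"
  shows "B_num n k = 0"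
proof -
  have "degree (\<Prod>i=1..n. [:2 * i - 1, 1:] :: nat poly) \<le> (\<Sum>i=1..n. degree [:2 * i - 1, 1 :: nat:])"
    using degree_prod_sum_le[of "{1..n}" "\<lambda>i. [:2 * i - 1, 1 :: nat:]"] by (simp add: o_def)
  also have "\<dots> = n"
    by simp
  finally show ?thesis
    unfolding B_num_def using assms by (intro coeff_eq_0) linarith
qed

text \<open>
  The unsigned Stirling numbers of the first kind are \<^const>\<open>stirling\<close>, which the library
  defines by recursion; they are the coefficients of the rising factorial.
\<close>

lemma coeff_rising_factorial_eq_stirling:
  "coeff (\<Prod>i<n. [:i, 1:]) k = stirling n k"
proof -
  have "(\<Prod>i<n. [:i, 1:]) = pochhammer [:0, 1 :: nat:] n"
    by (auto simp: pochhammer_prod of_nat_poly lessThan_atLeast0 intro!: prod.cong)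
  also have "\<dots> = (\<Sum>j\<le>n. of_nat (stirling n j) * [:0, 1:] ^ j)"
    by (rule stirling_pochhammer [symmetric])
  also have "\<dots> = (\<Sum>j\<le>n. monom (stirling n j) j)"
    by (simp add: monom_altdef of_nat_poly)
  finally show ?thesis
    by (simp add: coeff_sum)
qed

text \<open>
  The series below have only finitely many nonzero terms, since \<^term>\<open>B_num n k\<close> and
  \<^term>\<open>stirling n k\<close> vanish for \<^term>\<open>k > n\<close>.
\<close>

definition p_walk :: "nat \<Rightarrow> nat \<Rightarrow> real" where
  "p_walk n d = 2 / (2 ^ n * fact n) * (\<Sum>r. real (B_num n (d + 1 + 2 * r)))"

definition p_br :: "nat \<Rightarrow> nat \<Rightarrow> real" where
  "p_br n d = 2 / fact n * (\<Sum>r. real (stirling n (d + 2 + 2 * r)))"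

text \<open>Only meaningful for \<^term>\<open>n \<ge> 1\<close>, because of the truncated \<^term>\<open>n - 1\<close>.\<close>

definition p_Wend :: "nat \<Rightarrow> nat \<Rightarrow> real" where
  "p_Wend n d = 1 / 2 ^ (n - 1) * (\<Sum>j=d..n-1. real ((n - 1) choose j))"

text \<open>The number of cycles of a permutation of \<open>{1..n}\<close>, fixed points included.\<close>

definition num_cycles :: "nat \<Rightarrow> (nat \<Rightarrow> nat) \<Rightarrow> nat" where
  "num_cycles n \<sigma> = card (orbit \<sigma> ` {1..n})"

definition unif_perm :: "nat \<Rightarrow> (nat \<Rightarrow> nat) pmf" where
  "unif_perm n = pmf_of_set {\<sigma>. \<sigma> permutes {1..n}}"

definition ewens_weight :: "real \<Rightarrow> nat \<Rightarrow> (nat \<Rightarrow> nat) \<Rightarrow> real" where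
  "ewens_weight \<theta> n \<sigma> =
     (if \<sigma> permutes {1..n}
      then \<theta> ^ num_cycles n \<sigma> / (\<Sum>\<tau> | \<tau> permutes {1..n}. \<theta> ^ num_cycles n \<tau>)
      else 0)"

definition ewens_perm :: "real \<Rightarrow> nat \<Rightarrow> (nat \<Rightarrow> nat) pmf" where
  "ewens_perm \<theta> n = embed_pmf (ewens_weight \<theta> n)"

text \<open>The weights form a probability mass function, so \<^const>\<open>embed_pmf\<close> applies.\<close>

lemma pmf_ewens_perm:
  assumes "\<theta> > 0"
  shows "pmf (ewens_perm \<theta> n) \<sigma> = ewens_weight \<theta> n \<sigma>"
proof -
  let ?S = "{\<tau>. \<tau> permutes {1..n}}"
  let ?Z = "\<Sum>\<tau>\<in>?S. \<theta> ^ num_cycles n \<tau>"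
  have fin: "finite ?S"
    by (simp add: finite_permutations)
  have "id \<in> ?S"
    by (simp add: permutes_id)
  hence Z: "?Z > 0"
    using fin assms by (intro sum_pos) (blast, blast, simp)
  have nonneg: "0 \<le> ewens_weight \<theta> n \<tau>" for \<tau>
    using Z assms by (auto simp: ewens_weight_def intro!: divide_nonneg_nonneg)
  have "(\<integral>\<^sup>+\<tau>. ennreal (ewens_weight \<theta> n \<tau>) \<partial>count_space UNIV) =
        (\<Sum>\<tau>\<in>?S. ennreal (ewens_weight \<theta> n \<tau>))"
    using fin by (intro nn_integral_count_space') (auto simp: ewens_weight_def)
  also have "\<dots> = ennreal (\<Sum>\<tau>\<in>?S. ewens_weight \<theta> n \<tau>)"
    using nonneg by (intro sum_ennreal) auto
  also have "(\<Sum>\<tau>\<in>?S. ewens_weight \<theta> n \<tau>) = (\<Sum>\<tau>\<in>?S. \<theta> ^ num_cycles n \<tau> / ?Z)"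
    by (intro sum.cong) (auto simp: ewens_weight_def)
  also have "\<dots> = 1"
    using Z by (simp flip: sum_divide_distrib)
  finally show ?thesis
    unfolding ewens_perm_def using nonneg by (intro pmf_embed_pmf) auto
qed

end

theory Submission
  imports Defs
begin

text \<open>
  Comparing coefficients in \<open>2 ^ n ((t + 1) / 2)\<^sup>(\<^sup>n\<^sup>)\<close> and in \<open>t (t + 1)\<^sup>(\<^sup>n\<^sup>-\<^sup>1\<^sup>)\<close>, where \<open>x\<^sup>(\<^sup>n\<^sup>)\<close>
  is the rising factorial, expresses \<open>B(n,m)\<close> and \<open>c(n,m)\<close> through \<open>c(n,k)\<close> resp. \<open>c(n-1,k)\<close> and
  binomial coefficients. Summing every second binomial coefficient of row \<open>k\<close> gives, by Pascal's rule,
  a tail of row \<open>k - 1\<close>, that is, \<open>2 ^ (k - 1)\<close> times the Wendel probability. On the other side,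
  inserting a new element into a permutation either creates a fixed point or extends a cycle,
  so that the cycle counts obey the Stirling recursion.
\<close>

section \<open>Cycle counts under insertion of a new element\<close>

text \<open>The composite sends \<open>a\<close> to \<open>b\<close> and the
  \<open>q\<close>-preimage of \<open>b\<close> to \<open>a\<close>. So \<open>a\<close> is spliced
  into the cycle of \<open>b\<close> just before \<open>b\<close>, and deleting it recovers the
  cycles of \<open>q\<close>.\<close>

lemma orbit_transpose_comp:
  assumes q: "q permutes S" and a: "a \<notin> S" and b: "b \<in> S" and x: "x \<in> S"
  shows "orbit (Transposition.transpose a b \<circ> q) x - {a} = orbit q x"
proof (intro equalityI subsetI)
  let ?p = "Transposition.transpose a b \<circ> q"
  have qa: "q a = a"
    using q a by (simp add: permutes_not_in)
  have qS: "q y \<in> S" if "y \<in> S" for y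
    using q that by (simp add: permutes_in_image)
  have sub: "orbit q x \<subseteq> S"
    using q x by (rule permutes_orbit_subset)
  {
    fix y assume "y \<in> orbit ?p x - {a}"
    then have "y \<in> orbit ?p x" "y \<noteq> a" by auto
    \<comment> \<open>When the composite visits \<open>a\<close>, which \<open>q\<close> cannot
      reach from \<open>x\<close>, the invariant records the next point \<open>b\<close>
      instead.\<close>
    from this(1) have "if y = a then b \<in> orbit q x else y \<in> orbit q x"
    proof induction
      case base
      show ?case
        using qS[OF x] a b orbit.base[of q x] by (auto simp: Transposition.transpose_def)
    next
      case (step y)
      show ?case
      proof (cases "y = a")
        case True
        with step a b qa show ?thesis by auto
      next
        case False
        with step have y: "y \<in> orbit q x" by simp
        with sub have "q y \<in> S" using qS by blast
        with orbit.step[OF y] a b show ?thesis by (auto simp: Transposition.transpose_def)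
      qed
    qed
    with \<open>y \<noteq> a\<close> show "y \<in> orbit q x" by simp
  next
    fix y assume y: "y \<in> orbit q x"
    \<comment> \<open>One step of \<open>q\<close> is one step of \<open>?p\<close>, or two if
      \<open>q z = b\<close>, because of the detour through \<open>a\<close>.\<close>
    have advance: "q z \<in> orbit ?p x" if z: "z \<in> S" and "z = x \<or> z \<in> orbit ?p x" for z
    proof -
      have pz: "?p z \<in> orbit ?p x"
        using that(2) by (auto intro: orbit.intros simp del: comp_apply)
      show ?thesis
      proof (cases "q z = b")
        case True
        then have "?p (?p z) = b" using qa by simp
        with orbit.step[OF pz] True show ?thesis by simp
      next
        case False
        moreover have "q z \<noteq> a" using qS[OF z] a by blast
        ultimately show ?thesis using pz by (simp add: Transposition.transpose_def)
      qed
    qed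
    from y have "y \<in> orbit ?p x"
      by induction (use advance x sub in blast)+
    with sub y a show "y \<in> orbit ?p x - {a}" by blast
  }
qed

lemma card_orbits_transpose_comp:
  assumes fin: "finite S" and q: "q permutes S" and a: "a \<notin> S" and b: "b \<in> S"
  shows "card (orbit (Transposition.transpose a b \<circ> q) ` insert a S) = card (orbit q ` S)"
proof -
  let ?p = "Transposition.transpose a b \<circ> q"
  have "?p permutes insert a S"
    using q b by (intro permutes_compose[OF permutes_subset[OF q] permutes_swap_id]) auto
  then have perm: "permutation ?p"
    using fin by (meson finite.insertI permutation_permutes)
  have "?p a = b"
    using q a by (simp add: permutes_not_in)
  then have "orbit ?p a = orbit ?p b"
    using permutation_orbit_step[OF perm, of a] by simp
  then have "orbit ?p ` insert a S = orbit ?p ` S"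
    using b by auto
  \<comment> \<open>Every orbit here contains some \<open>x\<close> of \<open>S\<close>, which
    survives the deletion of \<open>a\<close>; two orbits sharing a point coincide.\<close>
  moreover have "inj_on (\<lambda>A. A - {a}) (orbit ?p ` S)"
  proof (rule inj_onI, clarify)
    fix x y assume xy: "x \<in> S" "y \<in> S" and eq: "orbit ?p x - {a} = orbit ?p y - {a}"
    have "x \<in> orbit ?p x - {a}"
      using xy a permutation_self_in_orbit[OF perm] by blast
    with eq have "x \<in> orbit ?p y" by simp
    then show "orbit ?p x = orbit ?p y"
      using orbit_cyclic_eq3[OF cyclic_on_orbit'[OF perm]] by blast
  qed
  moreover have "(\<lambda>A. A - {a}) ` orbit ?p ` S = orbit q ` S"
    using orbit_transpose_comp[OF q a b] by (simp add: image_image cong: image_cong)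
  ultimately show ?thesis
    by (metis card_image)
qed

lemma card_orbits_insert_fixpoint:
  assumes fin: "finite S" and q: "q permutes S" and a: "a \<notin> S"
  shows "card (orbit q ` insert a S) = Suc (card (orbit q ` S))"
proof -
  have "orbit q a = {a}"
    using q a by (simp add: orbit_eq_singleton_iff permutes_not_in)
  moreover have "{a} \<notin> orbit q ` S"
    using permutes_orbit_subset[OF q] a by blast
  ultimately show ?thesis
    using fin by simp
qed

text \<open>A general \<open>f\<close> serves both expectations and the Ewens normalisation. It also
  drives the induction: a new fixed point replaces \<open>f\<close> by its shift by
  \<open>Suc\<close>.\<close>

lemma sum_permutations_num_cycles:
  fixes f :: "nat \<Rightarrow> 'a :: comm_semiring_1"
  shows "(\<Sum>\<sigma> | \<sigma> permutes {1..n}. f (num_cycles n \<sigma>)) = (\<Sum>k\<le>n. of_nat (stirling n k) * f k)"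
proof (induction n arbitrary: f)
  case 0
  show ?case by (simp add: num_cycles_def)
next
  case (Suc n)
  have ins: "{1..Suc n} = insert (Suc n) {1..n}"
    by auto
  let ?P = "{\<sigma>. \<sigma> permutes {1..n}}"
  have "(\<Sum>\<sigma> | \<sigma> permutes {1..Suc n}. f (num_cycles (Suc n) \<sigma>)) =
      (\<Sum>b\<in>insert (Suc n) {1..n}. \<Sum>q\<in>?P. f (num_cycles (Suc n) (Transposition.transpose (Suc n) b \<circ> q)))"
    unfolding ins by (rule sum_over_permutations_insert) auto
  also have "\<dots> = (\<Sum>q\<in>?P. f (num_cycles (Suc n) q)) +
      (\<Sum>b=1..n. \<Sum>q\<in>?P. f (num_cycles (Suc n) (Transposition.transpose (Suc n) b \<circ> q)))"
    by simp
  also have "(\<Sum>q\<in>?P. f (num_cycles (Suc n) q)) = (\<Sum>q\<in>?P. f (Suc (num_cycles n q)))"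
    unfolding num_cycles_def ins
    by (intro sum.cong arg_cong[where f = f] card_orbits_insert_fixpoint) auto
  \<comment> \<open>Each of the \<open>n\<close> ways to extend a cycle keeps the count, which
    yields the factor \<open>n\<close> of the Stirling recursion.\<close>
  also have "(\<Sum>b=1..n. \<Sum>q\<in>?P. f (num_cycles (Suc n) (Transposition.transpose (Suc n) b \<circ> q))) =
      (\<Sum>b=1..n. \<Sum>q\<in>?P. f (num_cycles n q))"
    unfolding num_cycles_def ins
    by (intro sum.cong arg_cong[where f = f] card_orbits_transpose_comp) auto
  also have "(\<Sum>q\<in>?P. f (Suc (num_cycles n q))) = (\<Sum>k\<le>n. of_nat (stirling n k) * f (Suc k))"
    by (rule Suc.IH)
  also have "(\<Sum>b=1..n. \<Sum>q\<in>?P. f (num_cycles n q)) = of_nat n * (\<Sum>k\<le>n. of_nat (stirling n k) * f k)"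
    by (simp add: Suc.IH del: One_nat_def)
  also have "\<dots> = (\<Sum>k\<le>Suc n. of_nat (n * stirling n k) * f k)"
    by (simp add: sum_distrib_left mult_ac)
  \<comment> \<open>The term at index 0 drops out: \<open>n * stirling n 0\<close> is 0 for every
    \<open>n\<close>.\<close>
  also have "\<dots> = (\<Sum>k\<le>n. of_nat (n * stirling n (Suc k)) * f (Suc k))"
    by (cases n) (simp_all add: sum.atMost_Suc_shift del: sum.atMost_Suc)
  finally show ?case
    by (simp add: sum.atMost_Suc_shift sum.distrib ring_distribs mult_ac add_ac del: sum.atMost_Suc)
qed

section \<open>Sums over every second binomial coefficient\<close>

lemma sum_choose_parity:
  "(\<Sum>r\<le>k. Suc k choose (d + 1 + 2 * r)) = (\<Sum>j=d..k. k choose j)"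
proof -
  \<comment> \<open>The two Pascal summands for each \<open>r\<close> are adjacent, so together they
    tile an interval.\<close>
  have two: "(\<Sum>r\<le>m. g (d + 2 * r) + g (d + 1 + 2 * r)) = (\<Sum>j=d..d + 1 + 2 * m. g j)"
    for g :: "nat \<Rightarrow> nat" and m
    by (induction m) simp_all
  have "(\<Sum>r\<le>k. Suc k choose (d + 1 + 2 * r)) = (\<Sum>j=d..d + 1 + 2 * k. k choose j)"
    using two[of "(choose) k" k] by simp
  also have "\<dots> = (\<Sum>j=d..k. k choose j)"
    by (rule sum.mono_neutral_right) auto
  finally show ?thesis .
qed

text \<open>At \<open>k = 0\<close> this fails for \<open>d = 0\<close>: the series is 0, but
  \<open>p_Wend 0 0 = 1\<close>.\<close>

lemma sums_choose_parity:
  assumes "k > 0"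
  shows "(\<lambda>r. real (k choose (d + 1 + 2 * r))) sums (2 ^ (k - 1) * p_Wend k d)"
proof -
  obtain k' where k': "k = Suc k'"
    using assms by (cases k) auto
  have "(\<lambda>r. real (k choose (d + 1 + 2 * r))) sums (\<Sum>r\<le>k'. real (k choose (d + 1 + 2 * r)))"
    by (rule sums_finite) (auto simp: k' binomial_eq_0 simp del: binomial_Suc_Suc)
  also have "(\<Sum>r\<le>k'. real (k choose (d + 1 + 2 * r))) = (\<Sum>j=d..k'. real (k' choose j))"
    using sum_choose_parity[of k' d] unfolding k' by (metis of_nat_sum)
  finally show ?thesis
    by (simp add: p_Wend_def k')
qed

section \<open>Expansions in powers of \<open>t + 1\<close>\<close>

lemma coeff_linear_power_binomial: "coeff ([:1, 1:] ^ k :: nat poly) m = k choose m"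
proof (induction k arbitrary: m)
  case (Suc k)
  then show ?case by (cases m) (simp_all add: coeff_pCons)
qed (auto simp: coeff_1)

lemma stirling_Suc_Suc_eq_sum_choose:
  "stirling (Suc n) (Suc m) = (\<Sum>k\<le>n. stirling n k * (k choose m))"
proof -
  have "pochhammer [:0, 1 :: nat:] (Suc n) = [:0, 1:] * pochhammer [:1, 1:] n"
    by (simp add: pochhammer_rec one_pCons)
  also have "pochhammer [:1, 1 :: nat:] n = (\<Sum>k\<le>n. of_nat (stirling n k) * [:1, 1:] ^ k)"
    by (rule stirling_pochhammer [symmetric])
  \<comment> \<open>The split-off factor \<open>t\<close> lowers the coefficient index by
    one.\<close>
  finally have "coeff (pochhammer [:0, 1 :: nat:] (Suc n)) (Suc m) =
      coeff (\<Sum>k\<le>n. of_nat (stirling n k) * [:1, 1:] ^ k) m"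
    by simp
  moreover have "pochhammer [:0, 1 :: nat:] (Suc n) = (\<Prod>i<Suc n. [:i, 1:])"
    by (auto simp: pochhammer_prod of_nat_poly lessThan_atLeast0 intro!: prod.cong)
  ultimately show ?thesis
    by (simp only: coeff_rising_factorial_eq_stirling)
       (simp add: coeff_sum of_nat_poly coeff_linear_power_binomial del: One_nat_def)
qed

lemma prod_add_multiples_eq_sum_stirling:
  fixes x c :: "'a :: comm_semiring_1"
  shows "(\<Prod>i<n. x + of_nat i * c) = (\<Sum>k\<le>n. of_nat (stirling n k) * x ^ k * c ^ (n - k))"
proof (induction n)
  case 0
  show ?case by simp
next
  case (Suc n)
  let ?f = "\<lambda>k. of_nat (n * stirling n k) * x ^ k * c ^ (Suc n - k)"
  have "(\<Sum>k\<le>n. of_nat (stirling n k) * x ^ k * c ^ (n - k)) * (of_nat n * c) = (\<Sum>k\<le>n. ?f k)"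
    by (auto simp: sum_distrib_right sum_distrib_left Suc_diff_le mult_ac intro!: sum.cong)
  also have "\<dots> = (\<Sum>k\<le>Suc n. ?f k)"
    by simp
  also have "\<dots> = (\<Sum>k\<le>n. of_nat (n * stirling n (Suc k)) * x ^ Suc k * c ^ (n - k))"
    by (cases n) (simp_all add: sum.atMost_Suc_shift del: sum.atMost_Suc)
  finally have c_part: "(\<Sum>k\<le>n. of_nat (stirling n k) * x ^ k * c ^ (n - k)) * (of_nat n * c) = \<dots>" .
  have x_part: "(\<Sum>k\<le>n. of_nat (stirling n k) * x ^ k * c ^ (n - k)) * x =
      (\<Sum>k\<le>n. of_nat (stirling n k) * x ^ Suc k * c ^ (n - k))"
    by (simp add: sum_distrib_right sum_distrib_left mult_ac)
  have "(\<Prod>i<Suc n. x + of_nat i * c) =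
      (\<Sum>k\<le>n. of_nat (stirling (Suc n) (Suc k)) * x ^ Suc k * c ^ (n - k))"
    by (simp only: prod.lessThan_Suc Suc.IH distrib_left x_part c_part flip: sum.distrib)
       (simp add: distrib_right add_ac)
  also have "\<dots> = (\<Sum>k\<le>Suc n. of_nat (stirling (Suc n) k) * x ^ k * c ^ (Suc n - k))"
    by (simp add: sum.atMost_Suc_shift del: sum.atMost_Suc stirling.simps(4))
  finally show ?case .
qed

lemma B_num_eq_sum_choose: "B_num n m = (\<Sum>k\<le>n. stirling n k * 2 ^ (n - k) * (k choose m))"
proof -
  have "(\<Prod>i=1..n. [:2 * i - 1, 1:]) = (\<Prod>i<n. [:1, 1:] + of_nat i * [:2 :: nat:])"
    \<comment> \<open>Here \<open>x = t + 1\<close> and \<open>c = 2\<close>; the truncated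
      \<open>2 * i - 1\<close> is harmless since \<open>i\<close> starts at 1.\<close>
    by (rule prod.reindex_bij_witness[of _ Suc "\<lambda>i. i - 1"]) (auto simp: of_nat_poly)
  also have "\<dots> = (\<Sum>k\<le>n. of_nat (stirling n k) * [:1, 1:] ^ k * [:2:] ^ (n - k))"
    by (rule prod_add_multiples_eq_sum_stirling)
  also have "\<dots> = (\<Sum>k\<le>n. smult (stirling n k * 2 ^ (n - k)) ([:1, 1:] ^ k))"
    by (simp add: of_nat_poly poly_const_pow mult_ac)
  finally show ?thesis
    by (simp add: B_num_def coeff_sum coeff_linear_power_binomial del: One_nat_def)
qed

section \<open>From the series to sums of Wendel probabilities\<close>

text \<open>Linearity reduces the series to binomial rows. The weight \<open>w k\<close> will be
  \<open>2 ^ (n - k)\<close> for the walk and 1 for the bridge.\<close>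

lemma suminf_stirling_weighted_choose_parity:
  assumes "n > 0"
  shows "(\<Sum>r. real (\<Sum>k\<le>n. stirling n k * w k * (k choose (d + 1 + 2 * r)))) =
    (\<Sum>k\<le>n. real (stirling n k) * real (w k) * 2 ^ (k - 1) * p_Wend k d)"
proof -
  have term_sums: "(\<lambda>r. real (stirling n k) * real (w k) * real (k choose (d + 1 + 2 * r))) sums
      (real (stirling n k) * real (w k) * (2 ^ (k - 1) * p_Wend k d))" for k
  proof (cases "k = 0")
    case True
    with assms show ?thesis by (cases n) auto
  next
    case False
    then show ?thesis by (intro sums_mult sums_choose_parity) auto
  qed
  have "(\<lambda>r. \<Sum>k\<le>n. real (stirling n k) * real (w k) * real (k choose (d + 1 + 2 * r))) sums
      (\<Sum>k\<le>n. real (stirling n k) * real (w k) * (2 ^ (k - 1) * p_Wend k d))"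
    by (intro sums_sum term_sums)
  then show ?thesis
    by (simp add: sums_iff mult_ac)
qed

lemma p_walk_eq_sum_p_Wend:
  assumes "n \<ge> 1"
  shows "p_walk n d = 1 / fact n * (\<Sum>k\<le>n. real (stirling n k) * p_Wend k d)"
proof -
  have "(\<Sum>r. real (B_num n (d + 1 + 2 * r))) =
      (\<Sum>k\<le>n. real (stirling n k) * real (2 ^ (n - k)) * 2 ^ (k - 1) * p_Wend k d)"
    unfolding B_num_eq_sum_choose using assms
    by (intro suminf_stirling_weighted_choose_parity) auto
  also have "\<dots> = (\<Sum>k\<le>n. 2 ^ (n - 1) * (real (stirling n k) * p_Wend k d))"
  proof (rule sum.cong[OF refl])
    fix k assume "k \<in> {..n}"
    show "real (stirling n k) * real (2 ^ (n - k)) * 2 ^ (k - 1) * p_Wend k d =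
        2 ^ (n - 1) * (real (stirling n k) * p_Wend k d)"
    \<comment> \<open>At \<open>k = 0\<close> the truncated \<open>k - 1\<close> spoils the identity
      of powers, but \<open>stirling n 0 = 0\<close>.\<close>
    proof (cases "k = 0")
      case True
      with assms show ?thesis by (cases n) auto
    next
      case False
      with \<open>k \<in> {..n}\<close> have "(2 :: real) ^ (n - k) * 2 ^ (k - 1) = 2 ^ (n - 1)"
        by (simp flip: power_add)
      then show ?thesis by (simp add: mult_ac flip: mult.assoc)
    qed
  qed
  finally have "(\<Sum>r. real (B_num n (d + 1 + 2 * r))) =
      2 ^ (n - 1) * (\<Sum>k\<le>n. real (stirling n k) * p_Wend k d)"
    by (simp add: sum_distrib_left)
  moreover have "(2 :: real) ^ n = 2 * 2 ^ (n - 1)"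
    using assms by (cases n) auto
  ultimately show ?thesis
    by (simp add: p_walk_def)
qed

lemma p_br_eq_sum_p_Wend:
  assumes "n \<ge> 2"
  shows "p_br n d = 1 / fact n * (\<Sum>k\<le>n - 1. 2 ^ k * real (stirling (n - 1) k) * p_Wend k d)"
proof -
  obtain m where n: "n = Suc m" and m: "m > 0"
    using assms by (cases n) auto
  have "stirling n (d + 2 + 2 * r) = (\<Sum>k\<le>m. stirling m k * 1 * (k choose (d + 1 + 2 * r)))" for r
    using stirling_Suc_Suc_eq_sum_choose[of m "d + 1 + 2 * r"] by (simp add: n del: stirling.simps(4))
  then have "p_br n d = 2 / fact n *
      (\<Sum>r. real (\<Sum>k\<le>m. stirling m k * 1 * (k choose (d + 1 + 2 * r))))"
    by (simp only: p_br_def)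
  also have "\<dots> = 2 / fact n * (\<Sum>k\<le>m. real (stirling m k) * real 1 * 2 ^ (k - 1) * p_Wend k d)"
    by (subst suminf_stirling_weighted_choose_parity[OF m]) (rule refl)
  \<comment> \<open>Absorbing the prefactor 2 turns \<open>2 ^ (k - 1)\<close> into the Ewens weight
    \<open>2 ^ k\<close>; the exception \<open>k = 0\<close> has Stirling number 0.\<close>
  also have "\<dots> = 1 / fact n * (\<Sum>k\<le>m. 2 * (real (stirling m k) * 2 ^ (k - 1) * p_Wend k d))"
    by (simp flip: sum_distrib_left)
  also have "\<dots> = 1 / fact n * (\<Sum>k\<le>m. 2 ^ k * real (stirling m k) * p_Wend k d)"
  proof (intro arg_cong[where f = "\<lambda>x. 1 / fact n * x"] sum.cong refl)
    fix k
    show "2 * (real (stirling m k) * 2 ^ (k - 1) * p_Wend k d) =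
        2 ^ k * real (stirling m k) * p_Wend k d"
      using m by (cases k; cases m) simp_all
  qed
  finally show ?thesis
    by (simp add: n)
qed

text \<open>
  The term \<open>k = 0\<close> needs \<open>n > 0\<close>: the truncated \<open>k - 1\<close> in \<^const>\<open>p_Wend\<close> makes
  \<open>p_Wend 0 0 = 1\<close>.
\<close>

lemma sum_stirling_p_Wend_truncate:
  assumes "n > 0"
  shows "(\<Sum>k\<le>n. w k * real (stirling n k) * p_Wend k d) =
    (\<Sum>k=d+1..n. w k * real (stirling n k) * p_Wend k d)"
proof (rule sum.mono_neutral_right)
  show "\<forall>k\<in>{..n} - {d + 1..n}. w k * real (stirling n k) * p_Wend k d = 0"
  proof
    fix k assume k: "k \<in> {..n} - {d + 1..n}"
    show "w k * real (stirling n k) * p_Wend k d = 0"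
    proof (cases "k = 0")
      case True
      with assms show ?thesis by (cases n) auto
    next
      case False
      with k have "{d..k - 1} = {}" by auto
      then show ?thesis by (simp add: p_Wend_def)
    qed
  qed
qed auto

section \<open>Expectations over random permutations\<close>

lemma expectation_unif_perm_num_cycles:
  "measure_pmf.expectation (unif_perm n) (\<lambda>\<sigma>. f (num_cycles n \<sigma>)) =
     1 / fact n * (\<Sum>k\<le>n. real (stirling n k) * f k)"
proof -
  have "{\<sigma>. \<sigma> permutes {1..n}} \<noteq> {}"
    using permutes_id by blast
  moreover have "card {\<sigma>. \<sigma> permutes {1..n}} = fact n"
    by (rule card_permutations) auto
  ultimately show ?thesis
    by (simp add: unif_perm_def integral_pmf_of_set finite_permutations sum_permutations_num_cycles
        del: One_nat_def)
qed

lemma expectation_ewens_perm_num_cycles: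
  assumes "\<theta> > 0"
  shows "measure_pmf.expectation (ewens_perm \<theta> n) (\<lambda>\<sigma>. f (num_cycles n \<sigma>)) =
    1 / pochhammer \<theta> n * (\<Sum>k\<le>n. \<theta> ^ k * real (stirling n k) * f k)"
proof -
  let ?S = "{\<sigma>. \<sigma> permutes {1..n}}"
  \<comment> \<open>The partition function is the cycle-count sum for
    \<open>f k = \<theta> ^ k\<close>, which is a rising factorial.\<close>
  have Z: "(\<Sum>\<tau>\<in>?S. \<theta> ^ num_cycles n \<tau>) = pochhammer \<theta> n"
    by (subst sum_permutations_num_cycles) (rule stirling_pochhammer)
  have "measure_pmf.expectation (ewens_perm \<theta> n) (\<lambda>\<sigma>. f (num_cycles n \<sigma>)) =
      (\<Sum>\<sigma>\<in>?S. f (num_cycles n \<sigma>) * pmf (ewens_perm \<theta> n) \<sigma>)"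
    by (rule integral_measure_pmf_real)
       (auto simp: finite_permutations set_pmf_iff pmf_ewens_perm[OF assms] ewens_weight_def
         split: if_splits)
  also have "\<dots> = (\<Sum>\<sigma>\<in>?S. \<theta> ^ num_cycles n \<sigma> * f (num_cycles n \<sigma>) / pochhammer \<theta> n)"
    by (intro sum.cong refl) (auto simp: pmf_ewens_perm[OF assms] ewens_weight_def Z[unfolded One_nat_def])
  also have "\<dots> = (\<Sum>k\<le>n. real (stirling n k) * (\<theta> ^ k * f k / pochhammer \<theta> n))"
    by (rule sum_permutations_num_cycles)
  finally show ?thesis
    by (simp add: sum_distrib_left sum_divide_distrib mult_ac)
qed

text \<open>Splitting the factor 1 off \<open>pochhammer 1 (Suc n)\<close> leaves
  \<open>pochhammer 2 n\<close>. This turns the Ewens normalisation on \<open>n - 1\<close> points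
  into \<open>fact n\<close>.\<close>

lemma pochhammer_two: "pochhammer 2 n = (fact (Suc n) :: 'a :: {comm_semiring_1, semiring_char_0})"
  by (simp add: pochhammer_fact pochhammer_rec del: fact_Suc)

theorem corollary23:
  shows
    "(\<forall>n d :: nat. n \<ge> 1 \<longrightarrow>
        p_walk n d =
          measure_pmf.expectation (unif_perm n) (\<lambda>\<sigma>. p_Wend (num_cycles n \<sigma>) d) \<and>
        measure_pmf.expectation (unif_perm n) (\<lambda>\<sigma>. p_Wend (num_cycles n \<sigma>) d) =
          1 / fact n * (\<Sum>k=d+1..n. real (stirling n k) * p_Wend k d)) \<and>
     (\<forall>n d :: nat. n \<ge> 2 \<longrightarrow>
        p_br n d =
          measure_pmf.expectation (ewens_perm 2 (n - 1)) (\<lambda>\<sigma>. p_Wend (num_cycles (n - 1) \<sigma>) d) \<and>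
        measure_pmf.expectation (ewens_perm 2 (n - 1)) (\<lambda>\<sigma>. p_Wend (num_cycles (n - 1) \<sigma>) d) =
          1 / fact n * (\<Sum>k=d+1..n-1. 2 ^ k * real (stirling (n - 1) k) * p_Wend k d))"
proof (intro conjI allI impI)
  fix n d :: nat
  assume n: "n \<ge> 1"
  let ?E = "measure_pmf.expectation (unif_perm n) (\<lambda>\<sigma>. p_Wend (num_cycles n \<sigma>) d)"
  have E: "?E = 1 / fact n * (\<Sum>k\<le>n. real (stirling n k) * p_Wend k d)"
    by (rule expectation_unif_perm_num_cycles)
  then show "p_walk n d = ?E"
    using n by (simp add: p_walk_eq_sum_p_Wend)
  show "?E = 1 / fact n * (\<Sum>k=d+1..n. real (stirling n k) * p_Wend k d)"
    unfolding E using n sum_stirling_p_Wend_truncate[of n "\<lambda>_. 1" d] by simp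
next
  fix n d :: nat
  assume n: "n \<ge> 2"
  let ?E = "measure_pmf.expectation (ewens_perm 2 (n - 1)) (\<lambda>\<sigma>. p_Wend (num_cycles (n - 1) \<sigma>) d)"
  have "?E = 1 / pochhammer 2 (n - 1) * (\<Sum>k\<le>n - 1. 2 ^ k * real (stirling (n - 1) k) * p_Wend k d)"
    by (rule expectation_ewens_perm_num_cycles) simp
  also have "pochhammer (2 :: real) (n - 1) = fact n"
    using n by (simp add: pochhammer_two del: fact_Suc)
  finally have E: "?E = 1 / fact n * (\<Sum>k\<le>n - 1. 2 ^ k * real (stirling (n - 1) k) * p_Wend k d)" .
  then show "p_br n d = ?E"
    using n by (simp add: p_br_eq_sum_p_Wend)
  show "?E = 1 / fact n * (\<Sum>k=d+1..n-1. 2 ^ k * real (stirling (n - 1) k) * p_Wend k d)"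
    unfolding E using n by (subst sum_stirling_p_Wend_truncate) auto
qed

end
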